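(* Let $\kappa>0$ be a constant. Any (possibly randomized) algorithm in the LOCAL model that, on every unweighted graph with $n$ nodes and maximum degree $\Delta$, finds an independent set of size at least $\kappa n/\Delta$ with success probability at least $1-1/\log n$ must spend $\Omega(\log^* n)$ rounds.
   Context: LOCAL model: the input graph is a synchronous communication network of $n$ computationally unbounded nodes, each with a unique $O(\log n)$-bit identifier; in each round each node may send a message of unbounded size to each of its neighbors. Initially a node knows only its own identifier and some polynomial upper bound on $n$ (it does not know $n$ or $\Delta$); at the end each node must know whether it belongs to the output set. Complexity is the number of rounds, as a function of $n$ (worst case). Randomized algorithms: each node has private random bits. Here $\Delta\ge 1$, $\log$ is to base 2, and $\log^* n$ is the iterated logarithm. *)

theory Defs
  imports "HOL-Probability.Probability"
begin

subsection \<open>Finite simple graphs\<close>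

text \<open>Vertices are natural numbers; every finite graph is isomorphic to one of this kind.
  A vertex name carries no information for the algorithm: nodes only see the
  identifiers of the network below.\<close>

record ugraph =
  verts :: "nat set"
  edges :: "nat set set"

definition simple_graph :: "('z) ugraph_scheme \<Rightarrow> bool" where
  "simple_graph G \<longleftrightarrow> finite (verts G) \<and> (\<forall>e\<in>edges G. e \<subseteq> verts G \<and> card e = 2)"

definition nbrs :: "('z) ugraph_scheme \<Rightarrow> nat \<Rightarrow> nat set" where
  "nbrs G v = {u. {u, v} \<in> edges G}"

definition degree :: "('z) ugraph_scheme \<Rightarrow> nat \<Rightarrow> nat" where
  "degree G v = card (nbrs G v)"

definition max_degree :: "('z) ugraph_scheme \<Rightarrow> nat" where
  "max_degree G = Max (degree G ` verts G)"

definition independent_set :: "('z) ugraph_scheme \<Rightarrow> nat set \<Rightarrow> bool" where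
  "independent_set G S \<longleftrightarrow> S \<subseteq> verts G \<and> (\<forall>u\<in>S. \<forall>v\<in>S. {u, v} \<notin> edges G)"


subsection \<open>Networks\<close>

text \<open>A network is an input of the LOCAL model: a graph with an identifier for each node, an
  upper bound on the number of nodes (known to all nodes), and for each node \<open>v\<close> an
  arbitrary numbering \<open>port v 0, \<dots>, port v (degree v - 1)\<close> of its neighbours, which
  lets a node address its neighbours individually although it does not know them initially.\<close>

record network = ugraph +
  ident :: "nat \<Rightarrow> nat"
  upper :: nat
  port :: "nat \<Rightarrow> nat \<Rightarrow> nat"

text \<open>The constants \<open>a\<close> and \<open>b\<close> are parameters of the model: identifiers have
  at most \<open>a * log 2 n\<close> bits, and the upper bound known to the nodes is at most \<open>n ^ b\<close>.\<close>

definition local_instance :: "nat \<Rightarrow> nat \<Rightarrow> network \<Rightarrow> bool" where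
  "local_instance a b G \<longleftrightarrow>
     simple_graph G \<and> verts G \<noteq> {} \<and> max_degree G \<ge> 1 \<and>
     inj_on (ident G) (verts G) \<and> (\<forall>v\<in>verts G. ident G v < card (verts G) ^ a) \<and>
     card (verts G) \<le> upper G \<and> upper G \<le> card (verts G) ^ b \<and>
     (\<forall>v\<in>verts G. bij_betw (port G v) {..<degree G v} (nbrs G v))"


subsection \<open>Algorithms and their executions\<close>

type_synonym tape = "nat \<Rightarrow> bool"

text \<open>\<open>init\<close> takes the identifier, the upper bound on the number of nodes and the private
  random bits. \<open>send s i\<close> is the message sent through port \<open>i\<close> in state \<open>s\<close>.
  \<open>receive\<close> gets the list of incoming messages, indexed by port, so that the degree becomes
  known with the first round. \<open>decision s = None\<close> means that the node is still
  running; otherwise the node has halted and knows whether it is in the output set.\<close>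

record ('s, 'm) local_algorithm =
  init :: "nat \<Rightarrow> nat \<Rightarrow> tape \<Rightarrow> 's"
  send :: "'s \<Rightarrow> nat \<Rightarrow> 'm"
  receive :: "'s \<Rightarrow> 'm list \<Rightarrow> 's"
  decision :: "'s \<Rightarrow> bool option"

definition port_to :: "network \<Rightarrow> nat \<Rightarrow> nat \<Rightarrow> nat" where
  "port_to G u v = inv_into {..<degree G u} (port G u) v"

text \<open>The state of a halted node is frozen, so its output is irrevocable. A node that wants
  to keep relaying information just does not halt yet.\<close>

primrec state :: "('s, 'm) local_algorithm \<Rightarrow> network \<Rightarrow> (nat \<Rightarrow> tape) \<Rightarrow> nat \<Rightarrow> nat \<Rightarrow> 's" where
  "state A G \<omega> 0 v = init A (ident G v) (upper G) (\<omega> v)"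
| "state A G \<omega> (Suc t) v =
     (let s = state A G \<omega> t v in
      if decision A s \<noteq> None then s
      else receive A s
             (map (\<lambda>i. let u = port G v i in send A (state A G \<omega> t u) (port_to G u v))
               [0..<degree G v]))"

definition halted :: "('s, 'm) local_algorithm \<Rightarrow> network \<Rightarrow> (nat \<Rightarrow> tape) \<Rightarrow> nat \<Rightarrow> bool" where
  "halted A G \<omega> t \<longleftrightarrow> (\<forall>v\<in>verts G. decision A (state A G \<omega> t v) \<noteq> None)"

definition output_set :: "('s, 'm) local_algorithm \<Rightarrow> network \<Rightarrow> (nat \<Rightarrow> tape) \<Rightarrow> nat set" where
  "output_set A G \<omega> = {v \<in> verts G. \<exists>t. decision A (state A G \<omega> t v) = Some True}"

text \<open>The number of rounds is \<open>\<infinity>\<close> if some node never halts.\<close>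

definition rounds :: "('s, 'm) local_algorithm \<Rightarrow> network \<Rightarrow> (nat \<Rightarrow> tape) \<Rightarrow> enat" where
  "rounds A G \<omega> = Inf (enat ` {t. halted A G \<omega> t})"


subsection \<open>Random bits, success probability and round complexity\<close>

definition tape_space :: "tape measure" where
  "tape_space = (\<Pi>\<^sub>M i\<in>UNIV. measure_pmf (bernoulli_pmf (1 / 2)))"

definition random_bits :: "network \<Rightarrow> (nat \<Rightarrow> tape) measure" where
  "random_bits G = (\<Pi>\<^sub>M v\<in>verts G. tape_space)"

definition finds_large_independent_set ::
    "real \<Rightarrow> ('s, 'm) local_algorithm \<Rightarrow> network \<Rightarrow> (nat \<Rightarrow> tape) \<Rightarrow> bool" where
  "finds_large_independent_set \<kappa> A G \<omega> \<longleftrightarrow>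
     (\<exists>t. halted A G \<omega> t) \<and> independent_set G (output_set A G \<omega>) \<and>
     real (card (output_set A G \<omega>)) \<ge> \<kappa> * real (card (verts G)) / real (max_degree G)"

text \<open>No measurability is imposed on algorithms. Since \<open>measure\<close> is \<open>0\<close> on non-measurable
  sets, a positive lower bound on the success probability entails that
  success is an event.\<close>

definition success_probability :: "real \<Rightarrow> ('s, 'm) local_algorithm \<Rightarrow> network \<Rightarrow> real" where
  "success_probability \<kappa> A G =
     measure (random_bits G) {\<omega> \<in> space (random_bits G). finds_large_independent_set \<kappa> A G \<omega>}"

definition round_complexity :: "nat \<Rightarrow> nat \<Rightarrow> ('s, 'm) local_algorithm \<Rightarrow> nat \<Rightarrow> enat" where
  "round_complexity a b A n =
     Sup {rounds A G \<omega> | G \<omega>.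
            local_instance a b G \<and> card (verts G) = n \<and> \<omega> \<in> space (random_bits G)}"

definition log_star :: "nat \<Rightarrow> nat" where
  "log_star n = (LEAST k. (log 2 ^^ k) (real n) \<le> 1)"

end

theory Submission
  imports Defs "HOL-Combinatorics.Multiset_Permutations"
begin

text \<open>Take a path of \<open>m\<close> cliques of about \<open>n / m\<close> vertices each, with the vertices of consecutive
  cliques joined, where \<open>m\<close> is a few-fold iterated logarithm of \<open>n\<close>. An independent set of size
  \<open>\<kappa> n / \<Delta>\<close> meets a constant fraction of the cliques. There are only \<open>m! < log n\<close>
  orders of the cliques along the path, so by a union bound some fixed random bits succeed for all
  of them. For these bits, whether a clique is met is a function \<open>f\<close> of the window of
  \<open>2 T + 3\<close> cliques around it.

  Suppose that \<open>f\<close> has no long false run on increasing sequences of cliques. As \<open>f\<close> is never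
  true on two consecutive windows, the length of the false run ending at a window properly colours
  the shift graph of windows with few colours. Linial's argument then shortens the windows one by
  one, exponentiating the number of colours each time, until single cliques are properly coloured;
  so a set of cliques larger than a tower of height \<open>O(T)\<close> contains a long false run.
  Concatenating such runs gives an order in which few cliques are met, unless
  \<open>T\<close> is of order \<open>log* n\<close>.\<close>

subsection \<open>Proper colourings of shift graphs\<close>

text \<open>Each induction step shortens the windows by one and replaces the colours by sets of
  colours, which exponentiates their number. At \<open>k = 0\<close> properness separates any two
  elements of \<open>R\<close>, so the colouring is injective.\<close>

lemma shift_coloring_bound:
  fixes col :: "nat list \<Rightarrow> nat"
  assumes "finite R"
    and "\<And>w. sorted_wrt (<) w \<Longrightarrow> set w \<subseteq> R \<Longrightarrow> length w = Suc k \<Longrightarrow> col w < c"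
    and "\<And>z. sorted_wrt (<) z \<Longrightarrow> set z \<subseteq> R \<Longrightarrow> length z = Suc (Suc k) \<Longrightarrow>
           col (butlast z) \<noteq> col (tl z)"
  shows "card R \<le> ((\<lambda>x. 2 ^ x) ^^ k) c"
  using assms(2,3)
proof (induction k arbitrary: col c)
  case 0
  have "inj_on (\<lambda>x. col [x]) R"
  proof (rule linorder_inj_onI)
    fix x y assume "x < y" "x \<in> R" "y \<in> R"
    then show "col [x] \<noteq> col [y]" using 0(2)[of "[x, y]"] by simp
  qed auto
  then have "card R = card ((\<lambda>x. col [x]) ` R)" by (simp add: card_image)
  also have "\<dots> \<le> card {..<c}" by (rule card_mono) (auto intro!: 0(1))
  finally show ?case by simp
next
  case (Suc k)
  \<comment> \<open>Numbers the sets of colours, so that the new colours are naturals again.\<close>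
  obtain h where h: "bij_betw h (Pow {..<c}) {0..<card (Pow {..<c})}"
    using ex_bij_betw_finite_nat[of "Pow {..<c}"] by auto
  \<comment> \<open>The new colour of a shorter window: the set of old colours of its one-element
    extensions to the right.\<close>
  define ext where "ext w = {col (w @ [y]) |y. y \<in> R \<and> last w < y}" for w
  have inc: "sorted_wrt (<) (w @ [y])"
    if w: "sorted_wrt (<) w" "length w = Suc k" "last w < y" for w :: "nat list" and y
  proof -
    obtain v x where vx: "w = v @ [x]" using w(2) by (cases w rule: rev_cases) auto
    show ?thesis using w unfolding vx by (force simp: sorted_wrt_append)
  qed
  have ext: "ext w \<in> Pow {..<c}"
    if "sorted_wrt (<) w" "set w \<subseteq> R" "length w = Suc k" for w
    using that inc Suc.prems(1) unfolding ext_def by auto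
  have "card R \<le> ((\<lambda>x. 2 ^ x) ^^ k) (2 ^ c)"
  proof (rule Suc.IH[where col = "\<lambda>w. h (ext w)"])
    fix w assume "sorted_wrt (<) w" "set w \<subseteq> R" "length w = Suc k"
    then show "h (ext w) < 2 ^ c"
      using bij_betwE[OF h] ext[of w] by (auto simp: card_Pow)
  next
    fix z assume z: "sorted_wrt (<) z" "set z \<subseteq> R" "length z = Suc (Suc k)"
    obtain x v where xv: "z = x # v" using z(3) by (cases z) auto
    obtain u y where uy: "z = u @ [y]" using z(3) by (cases z rule: rev_cases) auto
    have u: "sorted_wrt (<) u" "set u \<subseteq> R" "length u = Suc k"
      using z uy by (auto simp: sorted_wrt_append)
    have v: "sorted_wrt (<) v" "set v \<subseteq> R" "length v = Suc k"
      using z xv by auto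
    have "last u < y" "y \<in> R"
      using z uy u by (auto simp: sorted_wrt_append dest!: bspec[OF _ last_in_set])
    then have mem: "col z \<in> ext u" unfolding ext_def uy by auto
    \<comment> \<open>The windows \<open>u\<close> and \<open>v\<close> are told apart by the colour
      of \<open>z\<close>, which extends \<open>u\<close>. An extension \<open>v @ [y']\<close> of
      the same colour would make \<open>z @ [y']\<close> violate properness.\<close>
    have "col z \<notin> ext v"
    proof
      assume "col z \<in> ext v"
      then obtain y' where y': "y' \<in> R" "last v < y'" "col z = col (v @ [y'])"
        unfolding ext_def by auto
      have vy: "sorted_wrt (<) (v @ [y'])" using inc v y' by blast
      have "last v = y" using xv uy v(3) by (metis last_ConsR last_snoc list.size(3) nat.distinct(1))
      then have "sorted_wrt (<) (z @ [y'])"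
        using z y' unfolding uy by (force simp: sorted_wrt_append)
      then show False
        using Suc.prems(2)[of "z @ [y']"] z y' xv by auto
    qed
    with mem have "ext u \<noteq> ext v" by auto
    then have "h (ext u) \<noteq> h (ext v)"
      using bij_betw_imp_inj_on[OF h] ext[OF u] ext[OF v] by (meson inj_on_def)
    then show "h (ext (butlast z)) \<noteq> h (ext (tl z))"
      using xv uy by (metis butlast_snoc list.sel(3))
  qed
  then show ?case by (simp add: funpow_Suc_right del: funpow.simps(2))
qed

section \<open>False runs, and orders with few hits\<close>

lemma take_drop_append: "i + k \<le> length xs \<Longrightarrow> take k (drop i (xs @ ys)) = take k (drop i xs)"
  by auto

text \<open>The run is traced backwards from its last window \<open>e\<close>, keeping only the
  current window. The index counts steps, so index \<open>q\<close> stands for \<open>q + 1\<close>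
  windows.\<close>

primrec false_run :: "(nat list \<Rightarrow> bool) \<Rightarrow> nat set \<Rightarrow> nat \<Rightarrow> nat list \<Rightarrow> bool" where
  "false_run f R 0 e \<longleftrightarrow> \<not> f e"
| "false_run f R (Suc q) e \<longleftrightarrow>
     \<not> f e \<and> (\<exists>x\<in>R. x < hd e \<and> false_run f R q (x # butlast e))"

text \<open>Successive windows of a run overlap in all but one element, so the prepended elements
  glue together to one increasing list.\<close>

lemma false_run_list:
  assumes "false_run f R q e" "sorted_wrt (<) e" "set e \<subseteq> R" "length e = k" "k > 0"
  shows "\<exists>u. length u = q \<and> sorted_wrt (<) (u @ e) \<and> set u \<subseteq> R \<and>
             (\<forall>i\<le>q. \<not> f (take k (drop i (u @ e))))"
  using assms
proof (induction q arbitrary: e)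
  case 0
  then show ?case by auto
next
  case (Suc q)
  obtain x where x: "x \<in> R" "x < hd e" "false_run f R q (x # butlast e)" "\<not> f e"
    using Suc.prems(1) by auto
  obtain d y where e: "e = d @ [y]" using Suc.prems by (cases e rule: rev_cases) auto
  have xe: "sorted_wrt (<) (x # e)"
    using Suc.prems x(2) by (cases e) auto
  then have "sorted_wrt (<) (x # d)" unfolding e by (auto simp: sorted_wrt_append)
  then obtain u where u: "length u = q" "sorted_wrt (<) (u @ x # d)" "set u \<subseteq> R"
      "\<And>i. i \<le> q \<Longrightarrow> \<not> f (take k (drop i (u @ x # d)))"
    using Suc.IH[of "x # d"] x Suc.prems e by auto
  have sorted: "sorted_wrt (<) ((u @ [x]) @ e)"
    using u(2) xe unfolding e by (auto simp: sorted_wrt_append)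
  have "\<not> f (take k (drop i ((u @ [x]) @ e)))" if "i \<le> Suc q" for i
  proof (cases "i = Suc q")
    case True
    then show ?thesis using u(1) x(4) Suc.prems(4) by simp
  next
    case False
    then have "i \<le> q" using that by simp
    then have "take k (drop i ((u @ [x]) @ e)) = take k (drop i (u @ x # d))"
      using take_drop_append[of i k "u @ x # d" "[y]"] u(1) Suc.prems(4) unfolding e by simp
    then show ?thesis using u(4) \<open>i \<le> q\<close> by simp
  qed
  with sorted u x(1) show ?case by (intro exI[of _ "u @ [x]"]) auto
qed

lemma long_false_run:
  fixes R :: "nat set"
  assumes "finite R"
    and no2: "\<And>z. sorted_wrt (<) z \<Longrightarrow> set z \<subseteq> R \<Longrightarrow> length z = Suc (Suc k) \<Longrightarrow>
           \<not> (f (butlast z) \<and> f (tl z))"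
    and big: "((\<lambda>x. 2 ^ x) ^^ k) (Suc s) < card R"
  shows "\<exists>w. sorted_wrt (<) w \<and> set w \<subseteq> R \<and> length w = Suc k + s \<and>
             (\<forall>i\<le>s. \<not> f (take (Suc k) (drop i w)))"
proof (rule ccontr)
  assume neg: "\<not> ?thesis"
  have no_run: "\<not> false_run f R s e"
    if e: "sorted_wrt (<) e" "set e \<subseteq> R" "length e = Suc k" for e
  proof
    assume "false_run f R s e"
    then obtain u where "length u = s" "sorted_wrt (<) (u @ e)" "set u \<subseteq> R"
       "\<forall>i\<le>s. \<not> f (take (Suc k) (drop i (u @ e)))"
      using false_run_list[OF _ e] by blast
    then show False using neg e by (auto dest!: spec[of _ "u @ e"])
  qed
  \<comment> \<open>The number of windows in the longest false run ending at \<open>e\<close>; it is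
    \<open>0\<close> exactly when \<open>f e\<close> holds. By \<open>no_run\<close> it is at most
    \<open>s\<close>, which leaves \<open>Suc s\<close> colours.\<close>
  define L where "L e = (LEAST q. \<not> false_run f R q e)" for e
  have "card R \<le> ((\<lambda>x. 2 ^ x) ^^ k) (Suc s)"
  proof (rule shift_coloring_bound[where col = L])
    show "finite R" by fact
  next
    fix w assume "sorted_wrt (<) w" "set w \<subseteq> R" "length w = Suc k"
    then show "L w < Suc s" using no_run unfolding L_def by (simp add: Least_le less_Suc_eq_le)
  next
    fix z assume z: "sorted_wrt (<) z" "set z \<subseteq> R" "length z = Suc (Suc k)"
    obtain x v where xv: "z = x # v" using z(3) by (cases z) auto
    obtain y v' where v: "v = y # v'" using xv z(3) by (cases v) auto
    have bl: "butlast z = x # butlast v" using xv v by simp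
    have sv: "sorted_wrt (<) v" "set v \<subseteq> R" "length v = Suc k" using z xv by auto
    have run: "\<not> false_run f R (L v) v"
      unfolding L_def using no_run[OF sv] by (rule LeastI)
    have step: "false_run f R (Suc q) v" if "\<not> f v" "false_run f R q (butlast z)" for q
      using that z xv v bl by auto
    show "L (butlast z) \<noteq> L (tl z)"
    proof (cases "f v")
      case True
      then have "L v = 0" unfolding L_def by (simp add: Least_eq_0)
      \<comment> \<open>The window to the left of a true one is false, hence has a positive
        colour.\<close>
      have nf: "\<not> f (butlast z)" using no2[OF z] True xv by simp
      have sb: "sorted_wrt (<) (butlast z)" "set (butlast z) \<subseteq> R" "length (butlast z) = Suc k"
        using z sorted_wrt_take[of "(<)" z "Suc k"]
        by (auto simp: butlast_conv_take dest: in_set_takeD)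
      have "\<not> false_run f R (L (butlast z)) (butlast z)"
        unfolding L_def using no_run[OF sb] by (rule LeastI)
      then have "L (butlast z) \<noteq> 0" using nf by (metis false_run.simps(1))
      then show ?thesis using \<open>L v = 0\<close> xv by simp
    next
      case False
      show ?thesis
      proof
        assume eq: "L (butlast z) = L (tl z)"
        \<comment> \<open>If the colours agreed, a run with index \<open>l\<close> would end at the
          left window; appending \<open>v\<close> would give the run that \<open>L v = Suc l\<close>
          excludes.\<close>
        have "L v \<noteq> 0" using run False by (metis false_run.simps(1))
        then obtain l where l: "L v = Suc l" by (cases "L v") auto
        then have "l < (LEAST q. \<not> false_run f R q (butlast z))"
          using eq xv unfolding L_def by simp
        then have "false_run f R l (butlast z)" using not_less_Least by blast
        then show False using step False run l by auto
      qed
    qed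
  qed
  then show False using big by simp
qed

definition hits :: "nat \<Rightarrow> (nat list \<Rightarrow> bool) \<Rightarrow> nat list \<Rightarrow> nat set" where
  "hits k f xs = {i. i + k \<le> length xs \<and> f (take k (drop i xs))}"

lemma finite_hits: "finite (hits k f xs)"
  by (rule finite_subset[of _ "{..length xs}"]) (auto simp: hits_def)

text \<open>Runs without hits are split off greedily and concatenated: a window is hit only if it
  straddles two runs or lies in the small remainder.\<close>

lemma arrangement_with_few_hits:
  fixes R :: "nat set"
  assumes "finite R"
    and "\<And>z. sorted_wrt (<) z \<Longrightarrow> set z \<subseteq> R \<Longrightarrow> length z = Suc (Suc k) \<Longrightarrow>
           \<not> (f (butlast z) \<and> f (tl z))"
  shows "\<exists>xs. distinct xs \<and> set xs = R \<and>
           (Suc k + s) * card (hits (Suc k) f xs)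
             \<le> Suc k * card R + (Suc k + s) * ((\<lambda>x. 2 ^ x) ^^ k) (Suc s)"
  using assms
proof (induction "card R" arbitrary: R rule: less_induct)
  case less
  let ?B = "((\<lambda>x. 2 ^ x) ^^ k) (Suc s) :: nat"
  let ?l = "Suc k + s"
  show ?case
  proof (cases "card R \<le> ?B")
    case True
    obtain xs where xs: "set xs = R" "distinct xs"
      using finite_distinct_list less.prems(1) by blast
    have "hits (Suc k) f xs \<subseteq> {..<card R}"
      using xs by (auto simp: hits_def distinct_card[symmetric])
    then have "card (hits (Suc k) f xs) \<le> card {..<card R}" by (intro card_mono) auto
    then have "card (hits (Suc k) f xs) \<le> ?B" using True by simp
    then have "?l * card (hits (Suc k) f xs) \<le> ?l * ?B" by (rule mult_le_mono2)
    then show ?thesis using xs by (intro exI[of _ xs]) auto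
  next
    case False
    then obtain w where w: "sorted_wrt (<) w" "set w \<subseteq> R" "length w = ?l"
        "\<And>i. i \<le> s \<Longrightarrow> \<not> f (take (Suc k) (drop i w))"
      using long_false_run[OF less.prems(1), of k f s] less.prems(2) by auto
    have dw: "distinct w" using w(1) strict_sorted_iff by blast
    have cw: "card (set w) = ?l" using dw w(3) distinct_card by metis
    have cR: "card (R - set w) + ?l = card R"
      using cw w(2) less.prems(1) by (metis card_Diff_subset card_mono finite_set le_add_diff_inverse2)
    then have "card (R - set w) < card R" by simp
    then obtain xs where xs: "distinct xs" "set xs = R - set w"
        "?l * card (hits (Suc k) f xs) \<le> Suc k * card (R - set w) + ?l * ?B"
      using less.hyps[of "R - set w"] less.prems by auto
    \<comment> \<open>Windows starting up to \<open>s\<close> lie inside the run \<open>w\<close>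
      and are not hit; those starting at \<open>?l\<close> or later are windows of
      \<open>xs\<close>. Only the \<open>k\<close> starts in between straddle the border, so a run
      of length \<open>?l\<close> costs at most \<open>Suc k\<close> hits.\<close>
    have "hits (Suc k) f (w @ xs) \<subseteq> {s<..<?l} \<union> (\<lambda>i. i + ?l) ` hits (Suc k) f xs"
    proof
      fix i assume i: "i \<in> hits (Suc k) f (w @ xs)"
      consider "i \<le> s" | "s < i" "i < ?l" | "?l \<le> i" by linarith
      then show "i \<in> {s<..<?l} \<union> (\<lambda>i. i + ?l) ` hits (Suc k) f xs"
      proof cases
        case 1
        then have "take (Suc k) (drop i (w @ xs)) = take (Suc k) (drop i w)"
          using w(3) by (intro take_drop_append) simp
        then show ?thesis using i w(4)[OF 1] unfolding hits_def mem_Collect_eq by metis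
      next
        case 3
        then have "i - ?l \<in> hits (Suc k) f xs" using i w(3) by (auto simp: hits_def)
        moreover have "i = (i - ?l) + ?l" using 3 by simp
        ultimately show ?thesis by blast
      qed simp
    qed
    then have "card (hits (Suc k) f (w @ xs))
        \<le> card ({s<..<?l} \<union> (\<lambda>i. i + ?l) ` hits (Suc k) f xs)"
      by (intro card_mono) (auto simp: finite_hits)
    also have "\<dots> \<le> card {s<..<?l} + card ((\<lambda>i. i + ?l) ` hits (Suc k) f xs)"
      by (rule card_Un_le)
    also have "\<dots> \<le> Suc k + card (hits (Suc k) f xs)"
      by (intro add_mono card_image_le finite_hits) auto
    finally have "?l * card (hits (Suc k) f (w @ xs)) \<le> ?l * (Suc k + card (hits (Suc k) f xs))"
      by (rule mult_le_mono2)
    also have "\<dots> = Suc k * ?l + ?l * card (hits (Suc k) f xs)" by (simp add: algebra_simps)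
    also have "\<dots> \<le> Suc k * ?l + (Suc k * card (R - set w) + ?l * ?B)" using xs(3) by simp
    also have "\<dots> = Suc k * card R + ?l * ?B" unfolding cR[symmetric] by (simp add: algebra_simps)
    finally show ?thesis using xs w(2) dw by (intro exI[of _ "w @ xs"]) auto
  qed
qed

subsection \<open>Paths of cliques\<close>

text \<open>The case \<open>i = j\<close> is included on purpose: the same relation then yields the
  edges inside a clique and those between neighbouring cliques.\<close>

definition consecutive :: "nat list \<Rightarrow> nat \<Rightarrow> nat \<Rightarrow> bool" where
  "consecutive xs p q \<longleftrightarrow>
     (\<exists>i j. i < length xs \<and> j < length xs \<and> xs ! i = p \<and> xs ! j = q \<and> i \<le> Suc j \<and> j \<le> Suc i)"

definition clique_nbrs :: "nat \<Rightarrow> nat \<Rightarrow> nat list \<Rightarrow> nat \<Rightarrow> nat set" where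
  "clique_nbrs n m xs v = {u. u < n \<and> v < n \<and> u \<noteq> v \<and> consecutive xs (u mod m) (v mod m)}"

text \<open>Clique \<open>p\<close> consists of the vertices congruent to \<open>p\<close> modulo \<open>m\<close>; the list \<open>xs\<close> is the
  order of the cliques along the path, and neighbouring cliques are completely joined.\<close>

definition clique_path :: "nat \<Rightarrow> nat \<Rightarrow> nat list \<Rightarrow> network" where
  "clique_path n m xs =
     \<lparr>verts = {..<n}, edges = {{u, v} |u v. u \<in> clique_nbrs n m xs v},
      ident = (\<lambda>v. v), upper = n, port = (\<lambda>v. from_nat_into (clique_nbrs n m xs v))\<rparr>"

lemma consecutive_sym: "consecutive xs p q \<Longrightarrow> consecutive xs q p"
  unfolding consecutive_def by blast

lemma clique_path_simps [simp]:
  "verts (clique_path n m xs) = {..<n}" "ident (clique_path n m xs) v = v"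
  "upper (clique_path n m xs) = n"
  "port (clique_path n m xs) v = from_nat_into (clique_nbrs n m xs v)"
  by (simp_all add: clique_path_def)

lemma edge_clique_path: "{u, v} \<in> edges (clique_path n m xs) \<longleftrightarrow> u \<in> clique_nbrs n m xs v"
  unfolding clique_path_def clique_nbrs_def
  by (auto simp: doubleton_eq_iff intro: consecutive_sym)

lemma nbrs_clique_path [simp]: "nbrs (clique_path n m xs) v = clique_nbrs n m xs v"
  by (simp add: nbrs_def edge_clique_path)

lemma finite_clique_nbrs: "finite (clique_nbrs n m xs v)"
  by (rule finite_subset[of _ "{..<n}"]) (auto simp: clique_nbrs_def)

lemma card_residue_class_le:
  assumes "m > 0"
  shows "card {u::nat. u < n \<and> u mod m = q} \<le> n div m + 1"
proof -
  have "card {u. u < n \<and> u mod m = q} \<le> card {..n div m}"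
  proof (rule card_inj_on_le[where f = "\<lambda>u. u div m"])
    show "inj_on (\<lambda>u. u div m) {u. u < n \<and> u mod m = q}"
      by (rule inj_onI) (metis (mono_tags, lifting) div_mult_mod_eq mem_Collect_eq)
  qed (auto intro: div_le_mono)
  then show ?thesis by simp
qed

lemma clique_nbrs_at:
  assumes "distinct xs" "v < n" "v mod m = xs ! i" "i < length xs"
  shows "clique_nbrs n m xs v =
    {u. u < n \<and> u \<noteq> v \<and> (\<exists>j<length xs. i \<le> Suc j \<and> j \<le> Suc i \<and> u mod m = xs ! j)}"
proof -
  have "consecutive xs r (v mod m) \<longleftrightarrow> (\<exists>j<length xs. i \<le> Suc j \<and> j \<le> Suc i \<and> r = xs ! j)" for r
    unfolding consecutive_def assms(3) using assms(1,4) nth_eq_iff_index_eq by metis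
  then show ?thesis using assms(2) by (auto simp: clique_nbrs_def)
qed

lemma degree_clique_path_le:
  assumes "distinct xs" "set xs = {..<m}" "m > 0" "v < n"
  shows "degree (clique_path n m xs) v \<le> 3 * (n div m + 1)"
proof -
  have "v mod m \<in> set xs" using assms by simp
  then obtain i where i: "i < length xs" "xs ! i = v mod m" by (meson in_set_conv_nth)
  let ?C = "\<lambda>j. {u. u < n \<and> u mod m = xs ! j}"
  \<comment> \<open>At the ends of the path, \<open>i - 1\<close> truncates to \<open>0\<close> and
    \<open>xs ! (i + 1)\<close> may be unspecified. This is harmless, since the bound on a residue
    class holds for every residue.\<close>
  have "clique_nbrs n m xs v \<subseteq> ?C (i - 1) \<union> (?C i \<union> ?C (i + 1))"
  proof
    fix u assume "u \<in> clique_nbrs n m xs v"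
    then obtain j where j: "u < n" "i \<le> Suc j" "j \<le> Suc i" "u mod m = xs ! j"
      using clique_nbrs_at[OF assms(1,4) i(2)[symmetric] i(1)] by auto
    then have "j = i - 1 \<or> j = i \<or> j = i + 1" by linarith
    then show "u \<in> ?C (i - 1) \<union> (?C i \<union> ?C (i + 1))" using j by auto
  qed
  then have "degree (clique_path n m xs) v \<le> card (?C (i - 1) \<union> (?C i \<union> ?C (i + 1)))"
    unfolding degree_def nbrs_clique_path by (intro card_mono) auto
  also have "\<dots> \<le> card (?C (i - 1)) + (card (?C i) + card (?C (i + 1)))"
    by (meson card_Un_le add_left_mono order_trans)
  also have "\<dots> \<le> 3 * (n div m + 1)"
  proof -
    note le = card_residue_class_le[OF assms(3), of n]
    show ?thesis
      using add_mono[OF le[of "xs ! (i - 1)"] add_mono[OF le[of "xs ! i"] le[of "xs ! (i + 1)"]]]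
      by simp
  qed
  finally show ?thesis .
qed

lemma clique_path_max_degree:
  assumes "distinct xs" "set xs = {..<m}" "m > 0" "m < n"
  shows "max_degree (clique_path n m xs) \<le> 3 * (n div m + 1)"
    and "max_degree (clique_path n m xs) \<ge> 1"
proof -
  show "max_degree (clique_path n m xs) \<le> 3 * (n div m + 1)"
    unfolding max_degree_def using assms degree_clique_path_le[OF assms(1-3)]
    by (subst Max_le_iff) auto
  have "0 \<in> set xs" using assms by simp
  then obtain i where "i < length xs" "xs ! i = 0" by (metis in_set_conv_nth)
  then have "consecutive xs 0 0" unfolding consecutive_def by (intro exI[of _ i]) simp
  \<comment> \<open>As \<open>m < n\<close>, the vertices \<open>0\<close> and \<open>m\<close> both
    exist and share a clique, which gives an edge.\<close>
  then have "m \<in> clique_nbrs n m xs 0"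
    using assms by (simp add: clique_nbrs_def)
  then have "degree (clique_path n m xs) 0 \<ge> 1"
    unfolding degree_def nbrs_clique_path
    by (metis One_nat_def Suc_leI card_gt_0_iff empty_iff finite_clique_nbrs)
  also have "degree (clique_path n m xs) 0 \<le> max_degree (clique_path n m xs)"
    unfolding max_degree_def using assms by (intro Max_ge) auto
  finally show "max_degree (clique_path n m xs) \<ge> 1" .
qed

lemma local_instance_clique_path:
  assumes "distinct xs" "set xs = {..<m}" "m > 0" "m < n" "a \<ge> 1" "b \<ge> 1"
  shows "local_instance a b (clique_path n m xs)"
proof -
  have "simple_graph (clique_path n m xs)"
    unfolding simple_graph_def by (auto simp: clique_path_def clique_nbrs_def)
  moreover have "n \<le> n ^ a" "n \<le> n ^ b"
    using assms self_le_power[of n a] self_le_power[of n b] by simp_all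
  moreover have "bij_betw (from_nat_into (clique_nbrs n m xs v))
      {..<degree (clique_path n m xs) v} (clique_nbrs n m xs v)" for v
    unfolding degree_def nbrs_clique_path
    by (intro bij_betw_from_nat_into_finite finite_clique_nbrs)
  moreover have "{..<n} \<noteq> {}" using assms by auto
  ultimately show ?thesis
    unfolding local_instance_def using clique_path_max_degree[OF assms(1-4)]
    by (auto simp: inj_on_def)
qed

section \<open>Locality: what a node sees depends on a window of cliques\<close>

lemma clique_nbrs_window:
  assumes "distinct xs" "distinct ys" "i + k \<le> length xs" "j + k \<le> length ys"
    and "take k (drop i xs) = take k (drop j ys)"
    and "v < n" "v mod m = xs ! (i + p)" "1 \<le> p" "p + 1 < k"
  shows "clique_nbrs n m xs v = clique_nbrs n m ys v"
proof -
  have eq: "xs ! (i + q) = ys ! (j + q)" if "q < k" for q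
  proof -
    have "take k (drop i xs) ! q = xs ! (i + q)" "take k (drop j ys) ! q = ys ! (j + q)"
      using that assms(3,4) by auto
    then show ?thesis using assms(5) by simp
  qed
  \<comment> \<open>Positions are taken relative to the start \<open>h\<close> of the window. The
    bounds on \<open>p\<close> keep both adjacent cliques inside the window, so the neighbourhood
    can be read off from it.\<close>
  have at: "clique_nbrs n m zs v = {u. u < n \<and> u \<noteq> v \<and>
      (\<exists>q<k. p \<le> Suc q \<and> q \<le> Suc p \<and> u mod m = zs ! (h + q))}"
    if "distinct zs" "h + k \<le> length zs" "v mod m = zs ! (h + p)" for zs h
  proof -
    have iff: "(\<exists>j<length zs. h + p \<le> Suc j \<and> j \<le> Suc (h + p) \<and> r = zs ! j) \<longleftrightarrow>
          (\<exists>q<k. p \<le> Suc q \<and> q \<le> Suc p \<and> r = zs ! (h + q))" (is "?L \<longleftrightarrow> ?R") for r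
    proof
      assume ?L
      then obtain j where "j < length zs" "h + p \<le> Suc j" "j \<le> Suc (h + p)" "r = zs ! j" by auto
      then show ?R using assms(8,9) by (intro exI[of _ "j - h"]) auto
    next
      assume ?R
      then obtain q where "q < k" "p \<le> Suc q" "q \<le> Suc p" "r = zs ! (h + q)" by auto
      then show ?L using that(2) by (intro exI[of _ "h + q"]) auto
    qed
    have "h + p < length zs" using that(2) assms(9) by simp
    show ?thesis
      unfolding clique_nbrs_at[OF that(1) assms(6) that(3) \<open>h + p < length zs\<close>] iff by simp
  qed
  have iff: "(\<exists>q<k. p \<le> Suc q \<and> q \<le> Suc p \<and> r = xs ! (i + q)) \<longleftrightarrow>
      (\<exists>q<k. p \<le> Suc q \<and> q \<le> Suc p \<and> r = ys ! (j + q))" for r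
    using eq by metis
  have "v mod m = ys ! (j + p)" using assms(7,9) eq by simp
  show ?thesis
    unfolding at[OF assms(1,3,7)] at[OF assms(2,4) \<open>v mod m = ys ! (j + p)\<close>] iff by simp
qed

text \<open>Information travels one clique per round, and one further clique of margin fixes the
  degrees and ports of the nodes heard from. Ports enumerate the neighbour set by
  \<open>from_nat_into\<close>, so equal neighbour sets give equal port numberings. The random bits
  are the same in both networks.\<close>

lemma state_clique_path_window:
  assumes "distinct xs" "distinct ys" "i + k \<le> length xs" "j + k \<le> length ys"
    and win: "take k (drop i xs) = take k (drop j ys)"
  shows "v < n \<Longrightarrow> v mod m = xs ! (i + p) \<Longrightarrow> t + 1 \<le> p \<Longrightarrow> p + t + 1 < k \<Longrightarrow>
    state A (clique_path n m xs) \<omega> t v = state A (clique_path n m ys) \<omega> t v"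
proof (induction t arbitrary: p v)
  case 0
  then show ?case by simp
next
  case (Suc t)
  let ?G = "clique_path n m xs" and ?H = "clique_path n m ys"
  note nb = clique_nbrs_window[OF assms]
  have nv: "clique_nbrs n m xs v = clique_nbrs n m ys v"
    using nb[of v n m p] Suc.prems by simp
  have sv: "state A ?G \<omega> t v = state A ?H \<omega> t v"
    using Suc.IH[of v p] Suc.prems by simp
  have deg: "degree ?G v = degree ?H v" by (simp add: degree_def nv)
  have u: "state A ?G \<omega> t u = state A ?H \<omega> t u \<and> port_to ?G u v = port_to ?H u v"
    if nbr: "u \<in> clique_nbrs n m xs v" for u
  proof -
    obtain h where h: "u < n" "i + p \<le> Suc h" "h \<le> Suc (i + p)" "u mod m = xs ! h"
      using nbr clique_nbrs_at[OF assms(1) Suc.prems(1,2)] Suc.prems assms(3) by auto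
    \<comment> \<open>A neighbour sits at most one position away, so it keeps the margin required
      for \<open>t\<close> rounds.\<close>
    define q where "q = h - i"
    have q: "u mod m = xs ! (i + q)" "t + 1 \<le> q" "q + t + 1 < k"
      using h Suc.prems by (auto simp: q_def)
    have "clique_nbrs n m xs u = clique_nbrs n m ys u"
      using nb[of u n m q] h(1) q by simp
    then show ?thesis
      using Suc.IH[OF h(1) q] by (simp add: port_to_def degree_def)
  qed
  have port: "port ?G v l \<in> clique_nbrs n m xs v" if "l < degree ?G v" for l
    unfolding clique_path_simps
    using that by (intro from_nat_into) (auto simp: degree_def)
  have "map (\<lambda>i. let u = port ?G v i in send A (state A ?G \<omega> t u) (port_to ?G u v)) [0..<degree ?G v]
      = map (\<lambda>i. let u = port ?H v i in send A (state A ?H \<omega> t u) (port_to ?H u v)) [0..<degree ?H v]"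
  proof (rule map_cong)
    show "[0..<degree ?G v] = [0..<degree ?H v]" by (simp add: deg)
  next
    fix l assume "l \<in> set [0..<degree ?H v]"
    then have "l < degree ?G v" using deg by simp
    then show "(let u = port ?G v l in send A (state A ?G \<omega> t u) (port_to ?G u v)) =
        (let u = port ?H v l in send A (state A ?H \<omega> t u) (port_to ?H u v))"
      using u[OF port] nv by (simp add: Let_def)
  qed
  then show ?case unfolding state.simps Let_def sv by simp
qed

subsection \<open>Halting\<close>

lemma state_halted_mono:
  assumes "decision A (state A G \<omega> t v) \<noteq> None" "t \<le> t'"
  shows "state A G \<omega> t' v = state A G \<omega> t v"
  using assms(2,1) by (induction rule: dec_induct) (auto simp: Let_def)

lemma halted_mono: "halted A G \<omega> t \<Longrightarrow> t \<le> t' \<Longrightarrow> halted A G \<omega> t'"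
  unfolding halted_def by (metis state_halted_mono)

text \<open>An infimum over no rounds would be infinite, so some round qualifies and the infimum is
  attained.\<close>

lemma halted_if_rounds_le:
  assumes "rounds A G \<omega> \<le> enat T"
  shows "halted A G \<omega> T"
proof -
  have "{t. halted A G \<omega> t} \<noteq> {}"
    using assms by (auto simp: rounds_def Inf_enat_def split: if_splits)
  then have "rounds A G \<omega> \<in> enat ` {t. halted A G \<omega> t}"
    unfolding rounds_def by (meson image_is_empty wellorder_InfI ex_in_conv)
  then show ?thesis using assms halted_mono by force
qed

lemma output_set_eq:
  assumes "halted A G \<omega> T"
  shows "output_set A G \<omega> = {v \<in> verts G. decision A (state A G \<omega> T v) = Some True}"
proof -
  have "decision A (state A G \<omega> T v) = Some True"
    if v: "v \<in> verts G" "decision A (state A G \<omega> t v) = Some True" for v t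
  proof -
    have "decision A (state A G \<omega> T v) \<noteq> None" using assms v(1) unfolding halted_def by blast
    then show ?thesis
      using v(2) state_halted_mono[of A G \<omega> t v T] state_halted_mono[of A G \<omega> T v t]
      by (metis nle_le option.distinct(1))
  qed
  then show ?thesis unfolding output_set_def by blast
qed

subsection \<open>Deterministic lower bound\<close>

lemma permutation_window:
  assumes "distinct w" "set w \<subseteq> {..<m::nat}"
  obtains ys where "distinct ys" "set ys = {..<m}" "take (length w) ys = w"
proof
  let ?ys = "w @ sorted_list_of_set ({..<m} - set w)"
  show "distinct ?ys" "set ?ys = {..<m}" "take (length w) ?ys = w" using assms by auto
qed

text \<open>An independent set has at most one vertex per clique, so it suffices to bound the number
  of cliques met. Away from the ends of the path these correspond to hits of a window predicate,
  which \<open>arrangement_with_few_hits\<close> makes rare for a suitable order.\<close>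

lemma deterministic_lower_bound:
  assumes m: "m > 0"
    and large: "6 * C * (6 * C * (2 * T + 3)) < m"
      "18 * C * ((\<lambda>x. 2 ^ x) ^^ (2 * T + 2)) (Suc (18 * C * (2 * T + 3))) < m"
    and C: "C > 0"
    and halts: "\<And>xs. distinct xs \<Longrightarrow> set xs = {..<m} \<Longrightarrow> halted A (clique_path n m xs) \<omega> T"
    and indep: "\<And>xs. distinct xs \<Longrightarrow> set xs = {..<m} \<Longrightarrow>
      independent_set (clique_path n m xs) (output_set A (clique_path n m xs) \<omega>)"
  shows "\<exists>xs. distinct xs \<and> set xs = {..<m} \<and>
    6 * C * card (output_set A (clique_path n m xs) \<omega>) < m"
proof -
  define k where "k = 2 * T + 3"
  \<comment> \<open>With this length the windows straddling two runs contribute at most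
    \<open>m / (18 * C)\<close> hits.\<close>
  define s where "s = 18 * C * k"
  define Out where "Out xs = output_set A (clique_path n m xs) \<omega>" for xs
  have Out: "Out xs = {v. v < n \<and> decision A (state A (clique_path n m xs) \<omega> T v) = Some True}"
    if "distinct xs" "set xs = {..<m}" for xs
    using output_set_eq[OF halts[OF that]] by (simp add: Out_def)
  have len: "length xs = m" if "distinct xs" "set xs = {..<m}" for xs
    using distinct_card[of xs] that by simp
  \<comment> \<open>Whether the middle clique of the window is met, evaluated in some order that
    starts with the window. By \<open>key\<close> below, all orders containing the window agree,
    wherever it stands in them.\<close>
  define f where "f w \<longleftrightarrow> (\<exists>ys v. distinct ys \<and> set ys = {..<m} \<and> take k ys = w \<and>
      v \<in> Out ys \<and> v mod m = ys ! (T + 1))" for w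
  have f: "f (take k (drop i xs)) \<longleftrightarrow> (\<exists>v\<in>Out xs. v mod m = xs ! (i + T + 1))"
    if xs: "distinct xs" "set xs = {..<m}" "i + k \<le> m" for xs i
  proof -
    let ?w = "take k (drop i xs)"
    have key: "v \<in> Out xs \<and> v mod m = xs ! (i + T + 1) \<longleftrightarrow> v \<in> Out ys \<and> v mod m = ys ! (T + 1)"
      if ys: "distinct ys" "set ys = {..<m}" "take k ys = ?w" for ys v
    proof -
      have k: "k \<le> m" "T + 1 < k" using xs(3) by (auto simp: k_def)
      have "take k ys ! (T + 1) = ?w ! (T + 1)" using ys(3) by simp
      then have nth: "ys ! (T + 1) = xs ! (i + T + 1)"
        using k xs len[OF xs(1,2)] by (simp add: add.assoc)
      have st: "state A (clique_path n m xs) \<omega> T v = state A (clique_path n m ys) \<omega> T v"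
        if "v < n" "v mod m = xs ! (i + T + 1)"
      proof (rule state_clique_path_window)
        show "i + k \<le> length xs" "0 + k \<le> length ys" using xs k(1) len ys(1,2) by auto
        show "take k (drop i xs) = take k (drop 0 ys)" using ys(3) by simp
        show "v mod m = xs ! (i + (T + 1))" using that(2) by (simp add: add.assoc)
        show "T + 1 \<le> T + 1" "T + 1 + T + 1 < k" by (simp_all add: k_def)
      qed fact+
      show ?thesis unfolding Out[OF xs(1,2)] Out[OF ys(1,2)] mem_Collect_eq nth using st by metis
    qed
    have "distinct ?w" "set ?w \<subseteq> {..<m}" "length ?w = k"
      using xs len[OF xs(1,2)] by (auto dest: in_set_takeD in_set_dropD)
    then obtain ys where "distinct ys" "set ys = {..<m}" "take k ys = ?w"
      using permutation_window by metis
    then show ?thesis using key unfolding f_def by blast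
  qed
  have edge: False
    if xs: "distinct xs" "set xs = {..<m}" and uv: "u \<in> Out xs" "v \<in> Out xs" "u \<noteq> v"
      "consecutive xs (u mod m) (v mod m)" for xs u v
    using indep[OF xs] uv Out[OF xs] unfolding independent_set_def Out_def[symmetric] edge_clique_path
    by (auto simp: clique_nbrs_def)
  have k': "k = Suc (2 * T + 2)" by (simp add: k_def)
  \<comment> \<open>Two overlapping true windows would put output vertices into two consecutive
    cliques, which are completely joined.\<close>
  have no2: "\<not> (f (butlast z) \<and> f (tl z))"
    if z: "sorted_wrt (<) z" "set z \<subseteq> {..<m}" "length z = Suc k" for z
  proof
    assume hit: "f (butlast z) \<and> f (tl z)"
    have "distinct z" using z(1) strict_sorted_iff by blast
    then obtain xs where xs: "distinct xs" "set xs = {..<m}" "take (Suc k) xs = z"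
      using permutation_window z(2,3) by metis
    have km: "Suc k \<le> m" using z(3) xs(3) len[OF xs(1,2)] by (metis length_take min.bounded_iff order_refl)
    have "butlast z = take k (drop 0 xs)" "tl z = take k (drop 1 xs)"
      unfolding xs(3)[symmetric] using km len[OF xs(1,2)]
      by (simp add: butlast_take, simp add: tl_take drop_Suc)
    then obtain u v where uv: "u \<in> Out xs" "u mod m = xs ! (T + 1)" "v \<in> Out xs" "v mod m = xs ! (T + 2)"
      using hit f[OF xs(1,2), of 0] f[OF xs(1,2), of 1] km by auto
    have tm: "T + 2 < m" using km by (simp add: k_def)
    then have "u \<noteq> v" using uv xs(1) len[OF xs(1,2)] by (auto simp: nth_eq_iff_index_eq)
    moreover have "consecutive xs (u mod m) (v mod m)"
      unfolding consecutive_def using uv tm len[OF xs(1,2)]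
      by (intro exI[of _ "T + 1"] exI[of _ "T + 2"]) auto
    ultimately show False using edge[OF xs(1,2) uv(1,3)] by blast
  qed
  let ?B = "((\<lambda>x. 2 ^ x) ^^ (2 * T + 2)) (Suc s) :: nat"
  obtain xs where xs: "distinct xs" "set xs = {..<m}"
      and few: "(k + s) * card (hits k f xs) \<le> k * m + (k + s) * ?B"
    using arrangement_with_few_hits[of "{..<m}" "2 * T + 2" f s] no2 unfolding k' by auto
  note lm = len[OF xs]
  define P where "P = {i. i < m \<and> (\<exists>v\<in>Out xs. v mod m = xs ! i)}"
  have "card (Out xs) \<le> card ((\<lambda>i. xs ! i) ` P)"
  proof (rule card_inj_on_le[where f = "\<lambda>v. v mod m"])
    show "inj_on (\<lambda>v. v mod m) (Out xs)"
    proof (rule inj_onI, rule ccontr)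
      fix u v assume uv: "u \<in> Out xs" "v \<in> Out xs" "u mod m = v mod m" "u \<noteq> v"
      have "u mod m \<in> set xs" using xs(2) m by simp
      then have "consecutive xs (u mod m) (v mod m)"
        unfolding consecutive_def uv(3)[symmetric] by (metis in_set_conv_nth le_SucI order_refl)
      then show False using edge[OF xs] uv by blast
    qed
    show "(\<lambda>v. v mod m) ` Out xs \<subseteq> (\<lambda>i. xs ! i) ` P"
    proof
      fix r assume "r \<in> (\<lambda>v. v mod m) ` Out xs"
      then obtain v where v: "v \<in> Out xs" "r = v mod m" by blast
      then have "r \<in> set xs" using xs(2) m by simp
      then obtain i where "i < m" "xs ! i = r" using lm by (metis in_set_conv_nth)
      then show "r \<in> (\<lambda>i. xs ! i) ` P" using v unfolding P_def by (intro image_eqI[of _ _ i]) auto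
    qed
    show "finite ((\<lambda>i. xs ! i) ` P)" by (simp add: P_def)
  qed
  also have "\<dots> \<le> card P" by (rule card_image_le) (simp add: P_def)
  \<comment> \<open>The \<open>T + 1\<close> positions at either end are not the middle of a full
    window and are all counted as met; together they are fewer than \<open>k\<close>.\<close>
  also have "\<dots> \<le> card ({..<T + 1} \<union> ({m - (T + 1)..<m} \<union> (\<lambda>i. i + T + 1) ` hits k f xs))"
  proof (rule card_mono)
    show "P \<subseteq> {..<T + 1} \<union> ({m - (T + 1)..<m} \<union> (\<lambda>i. i + T + 1) ` hits k f xs)"
    proof
      fix i assume i: "i \<in> P"
      show "i \<in> {..<T + 1} \<union> ({m - (T + 1)..<m} \<union> (\<lambda>i. i + T + 1) ` hits k f xs)"
      proof (cases "T + 1 \<le> i \<and> i < m - (T + 1)")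
        case True
        define h where "h = i - (T + 1)"
        have h: "i = h + T + 1" "h + k \<le> m" using True by (auto simp: h_def k_def)
        then have "h \<in> hits k f xs"
          using i f[OF xs h(2)] lm unfolding hits_def P_def by auto
        then show ?thesis using h(1) by blast
      next
        case False
        then show ?thesis using i by (auto simp: P_def)
      qed
    qed
  qed (simp add: finite_hits)
  also have "\<dots> \<le> card {..<T + 1} + (card {m - (T + 1)..<m} + card ((\<lambda>i. i + T + 1) ` hits k f xs))"
    by (meson card_Un_le add_left_mono order_trans)
  also have "\<dots> \<le> k + card (hits k f xs)"
  proof -
    have "card ((\<lambda>i. i + T + 1) ` hits k f xs) \<le> card (hits k f xs)"
      by (intro card_image_le finite_hits)
    then show ?thesis by (simp add: k_def)
  qed
  finally have cO: "card (Out xs) \<le> k + card (hits k f xs)" .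
  let ?N = "card (hits k f xs)"
  have kpos: "0 < k" by (simp add: k_def)
  \<comment> \<open>The case split keeps the subtraction \<open>?N - ?B\<close> from truncating.
    Otherwise \<open>few\<close> bounds it, and \<open>s = 18 * C * k\<close> lets the factor
    \<open>k\<close> cancel.\<close>
  have "18 * C * ?N \<le> m + 18 * C * ?B"
  proof (cases "?N \<le> ?B")
    case True
    then show ?thesis by (simp add: trans_le_add2)
  next
    case False
    have "k * (18 * C * (?N - ?B)) = s * (?N - ?B)" by (simp only: s_def mult_ac)
    also have "\<dots> \<le> (k + s) * (?N - ?B)" by (rule mult_le_mono1) simp
    also have "\<dots> \<le> k * m" using few unfolding diff_mult_distrib2 by linarith
    finally have "18 * C * (?N - ?B) \<le> m" using kpos by simp
    then show ?thesis using False unfolding diff_mult_distrib2 by linarith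
  qed
  moreover have "18 * C * ?B < m" using large(2) by (simp add: s_def k_def)
  moreover have "6 * C * (6 * C * k) < m" using large(1) by (simp add: k_def)
  moreover have "18 * C * k \<le> 6 * C * (6 * C * k)" using C by simp
  \<comment> \<open>Straddling windows, the small remainder and the ends of the path each account
    for at most \<open>m / (18 * C)\<close>.\<close>
  ultimately have "18 * C * (k + ?N) < 3 * m" unfolding add_mult_distrib2 by linarith
  then have "18 * C * card (Out xs) < 3 * m"
    using cO by (meson le_less_trans mult_le_mono2)
  then show ?thesis using xs unfolding Out_def by auto
qed

subsection \<open>Towers and the iterated logarithm\<close>

primrec tower :: "nat \<Rightarrow> nat" where
  "tower 0 = 1"
| "tower (Suc k) = 2 ^ tower k"

lemma less_tower: "k < tower k"
  by (induction k) (auto intro: le_less_trans[OF _ less_exp] simp: Suc_le_eq)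

lemma tower_mono: "i \<le> j \<Longrightarrow> tower i \<le> tower j"
  by (rule lift_Suc_mono_le[of tower]) (auto intro: less_imp_le less_exp)

lemma power_le_tower: "2 ^ k \<le> tower k"
  by (cases k) (auto simp del: power_Suc intro: power_increasing simp: Suc_le_eq less_tower)

lemma funpow_le_tower: "x \<le> tower r \<Longrightarrow> ((\<lambda>x. 2 ^ x) ^^ k) x \<le> tower (k + r)"
  by (induction k) (auto intro: power_increasing)

text \<open>Requiring all iterates to exceed \<open>1\<close> keeps every logarithm within its
  domain, so each can be inverted by an exponential.\<close>

lemma less_if_iterated_log_gt_1:
  "(\<And>i. i \<le> j \<Longrightarrow> 1 < (log 2 ^^ i) x) \<Longrightarrow> real (tower j) < x"
proof (induction j arbitrary: x)
  case 0
  then show ?case using 0[of 0] by simp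
next
  case (Suc j)
  have "1 < (log 2 ^^ i) (log 2 x)" if "i \<le> j" for i
    using Suc.prems[of "Suc i"] that by (simp add: funpow_Suc_right del: funpow.simps(2))
  then have "real (tower j) < log 2 x" by (rule Suc.IH)
  moreover have "1 < x" using Suc.prems[of 0] by simp
  ultimately have "2 powr real (tower j) < x" by (simp add: less_log_iff)
  then show ?case by (simp add: powr_realpow)
qed

lemma tower_less_if_le_log_star:
  assumes "Suc k \<le> log_star n"
  shows "tower k < n"
proof -
  have "1 < (log 2 ^^ i) (real n)" if "i \<le> k" for i
    using not_less_Least[of i "\<lambda>k. (log 2 ^^ k) (real n) \<le> 1"] that assms
    unfolding log_star_def by force
  then have "real (tower k) < real n" by (rule less_if_iterated_log_gt_1)
  then show ?thesis by simp
qed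

lemma iterated_log_ge_tower:
  "real (tower (j + i)) \<le> x \<Longrightarrow> real (tower i) \<le> (log 2 ^^ j) x"
proof (induction j arbitrary: x)
  case (Suc j)
  have "0 < x" using Suc.prems by (smt (verit) less_tower of_nat_0_less_iff gr_zeroI not_less_zero)
  moreover have "2 powr real (tower (j + i)) \<le> x" using Suc.prems by (simp add: powr_realpow)
  ultimately have "real (tower (j + i)) \<le> log 2 x" by (simp add: le_log_iff)
  then show ?case using Suc.IH[of "log 2 x"] by (simp add: funpow_Suc_right del: funpow.simps(2))
qed simp

lemma le_log_star:
  assumes "tower K \<le> n"
  shows "K \<le> log_star n"
proof -
  \<comment> \<open>The \<open>LEAST\<close> in \<open>log_star\<close> is meaningful only if the
    iteration reaches \<open>1\<close>; otherwise \<open>x\<close> would exceed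
    \<open>tower n\<close> for \<open>x = n\<close>.\<close>
  have "\<exists>k. (log 2 ^^ k) (real n) \<le> 1"
  proof (rule ccontr)
    assume "\<not> ?thesis"
    then have "real (tower n) < real n" by (intro less_if_iterated_log_gt_1) (auto simp: not_le)
    then show False using less_tower[of n] by simp
  qed
  then have le: "(log 2 ^^ log_star n) (real n) \<le> 1" unfolding log_star_def by (rule LeastI_ex)
  show ?thesis
  proof (rule ccontr)
    assume "\<not> K \<le> log_star n"
    then have "tower (log_star n + 1) \<le> n" using assms tower_mono[of "log_star n + 1" K] by simp
    then have "real (tower 1) \<le> (log 2 ^^ log_star n) (real n)" by (intro iterated_log_ge_tower) simp
    then show False using le by simp
  qed
qed

subsection \<open>Derandomization and the lower bound\<close>

lemma prob_space_random_bits: "prob_space (random_bits G)"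
  unfolding random_bits_def tape_space_def
  by (intro prob_space_PiM measure_pmf.prob_space_axioms)

text \<open>Each of the \<open>fact m\<close> orders fails with probability at most
  \<open>1 / log 2 n\<close>, so the union of the failure events does not fill the space.\<close>

lemma common_success:
  assumes succ: "\<And>xs. distinct xs \<Longrightarrow> set xs = {..<m} \<Longrightarrow>
      success_probability \<kappa> A (clique_path n m xs) \<ge> 1 - 1 / log 2 (real n)"
    and fact: "real (fact m) < log 2 (real n)"
  obtains \<omega> where "\<omega> \<in> space (random_bits (clique_path n m []))"
    "\<And>xs. distinct xs \<Longrightarrow> set xs = {..<m} \<Longrightarrow> finds_large_independent_set \<kappa> A (clique_path n m xs) \<omega>"
proof -
  define M where "M = random_bits (clique_path n m [])"
  \<comment> \<open>The random bits depend only on the vertex set, so all orders share one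
    probability space.\<close>
  have M: "random_bits (clique_path n m xs) = M" for xs by (simp add: M_def random_bits_def)
  interpret prob_space M unfolding M_def by (rule prob_space_random_bits)
  define I where "I = permutations_of_set {..<m}"
  define E where "E xs = {\<omega> \<in> space M. finds_large_independent_set \<kappa> A (clique_path n m xs) \<omega>}" for xs
  have I: "finite I" "card I = fact m" by (simp_all add: I_def)
  have log: "1 < log 2 (real n)" using fact by (metis fact_ge_1 le_less_trans of_nat_fact)
  have prob: "prob (E xs) \<ge> 1 - 1 / log 2 (real n)" if "xs \<in> I" for xs
    using succ[of xs] that by (simp add: success_probability_def M E_def I_def permutations_of_set_def)
  \<comment> \<open>A non-measurable set has \<open>measure\<close> \<open>0\<close>, which the
    positive bound on the success probability rules out.\<close>
  have E: "E xs \<in> events" if "xs \<in> I" for xs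
  proof (rule ccontr)
    assume "E xs \<notin> events"
    then have "prob (E xs) = 0" by (rule measure_notin_sets)
    moreover have "1 / log 2 (real n) < 1" using log by simp
    ultimately show False using prob[OF that] by simp
  qed
  have "prob (\<Union>xs\<in>I. space M - E xs) \<le> (\<Sum>xs\<in>I. prob (space M - E xs))"
    using I E by (intro finite_measure_subadditive_finite) auto
  also have "\<dots> \<le> (\<Sum>xs\<in>I. 1 / log 2 (real n))"
    using prob E by (intro sum_mono) (auto simp: prob_compl dest!: prob)
  also have "\<dots> = fact m / log 2 (real n)" using I by simp
  also have "\<dots> < 1" using fact log by simp
  finally have "prob (\<Union>xs\<in>I. space M - E xs) < prob (space M)" by (simp add: prob_space)
  then have "(\<Union>xs\<in>I. space M - E xs) \<noteq> space M" by auto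
  then obtain \<omega> where "\<omega> \<in> space M" "\<And>xs. xs \<in> I \<Longrightarrow> \<omega> \<in> E xs" by blast
  then show ?thesis
    using that[of \<omega>] by (auto simp: M_def E_def I_def permutations_of_set_def)
qed

lemma square_less_power_of_two: "5 \<le> (x::nat) \<Longrightarrow> x * x < 2 ^ x"
proof (induction x rule: dec_induct)
  case (step x)
  have "Suc x * Suc x = x * x + (2 * x + 1)" by simp
  also have "2 * x + 1 \<le> x * x" using step(1) mult_le_mono1[of 5 x x] by linarith
  finally show ?case using step by simp
qed simp

lemma fact_le_double_power: "5 \<le> m \<Longrightarrow> (fact m :: nat) \<le> 2 ^ 2 ^ m"
proof -
  assume m: "5 \<le> m"
  have "(fact m :: nat) \<le> m ^ m" using fact_le_power[of m, where 'a = nat] by simp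
  also have "\<dots> \<le> (2 ^ m) ^ m" by (intro power_mono) (auto intro: less_imp_le less_exp)
  also have "\<dots> = 2 ^ (m * m)" by (simp add: power_mult)
  also have "\<dots> \<le> 2 ^ 2 ^ m" using square_less_power_of_two[OF m] by (intro power_increasing) auto
  finally show ?thesis .
qed

lemma log_star_less:
  fixes A :: "('s, 'm) local_algorithm"
  assumes C: "C > 0" "1 / real C \<le> \<kappa>" and ab: "a \<ge> 1" "b \<ge> 1"
    and succ: "\<And>G. local_instance a b G \<Longrightarrow>
           success_probability \<kappa> A G \<ge> 1 - 1 / log 2 (real (card (verts G)))"
    and T: "round_complexity a b A n \<le> enat T"
  shows "log_star n < 4 * T + 36 * C * C + 20"
proof (rule ccontr)
  define L where "L = log_star n"
  \<comment> \<open>Minimality of \<open>log_star\<close> gives \<open>tower (L - 1) < n\<close>,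
    and \<open>tower (L - 1)\<close> is three exponentials above \<open>m\<close>. One logarithm
    still leaves \<open>2 ^ 2 ^ m\<close>, which is at least \<open>fact m\<close>, as the union
    bound demands.\<close>
  define m where "m = tower (L - 4)"
  assume "\<not> ?thesis"
  then have L: "4 * T + 36 * C * C + 20 \<le> L" by (simp add: L_def)
  have "Suc (L - 1) = L" using L by simp
  then have "tower (L - 1) < n" using tower_less_if_le_log_star[of "L - 1" n] by (simp add: L_def)
  moreover have "tower (L - 1) = 2 ^ 2 ^ 2 ^ m"
  proof -
    have "L - 1 = Suc (Suc (Suc (L - 4)))" using L by simp
    then show ?thesis by (simp add: m_def)
  qed
  ultimately have n: "2 ^ 2 ^ 2 ^ m < n" by simp
  have m5: "5 \<le> m" using less_tower[of "L - 4"] L by (simp add: m_def)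
  have "m < 2 ^ m" by (rule less_exp)
  also have "\<dots> < 2 ^ 2 ^ m" by (rule less_exp)
  also have "\<dots> < 2 ^ 2 ^ 2 ^ m" by (rule less_exp)
  finally have mn: "m < n" using n by simp
  have mpos: "m > 0" using m5 by simp
  have "real (fact m) \<le> real (2 ^ 2 ^ m)"
    using fact_le_double_power[OF m5] by (simp only: of_nat_le_iff)
  also have "\<dots> = log 2 (real (2 ^ 2 ^ 2 ^ m))" by (simp add: log_nat_power)
  also have "\<dots> < log 2 (real n)" using n by (subst log_less_cancel_iff) auto
  finally have fact: "real (fact m) < log 2 (real n)" .
  have inst: "local_instance a b (clique_path n m xs)" if "distinct xs" "set xs = {..<m}" for xs
    using local_instance_clique_path[OF that mpos mn ab] .
  obtain \<omega> where \<omega>: "\<omega> \<in> space (random_bits (clique_path n m []))"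
    "\<And>xs. distinct xs \<Longrightarrow> set xs = {..<m} \<Longrightarrow> finds_large_independent_set \<kappa> A (clique_path n m xs) \<omega>"
    using common_success[OF _ fact, of \<kappa> A] succ[OF inst] by auto
  have halts: "halted A (clique_path n m xs) \<omega> T" if xs: "distinct xs" "set xs = {..<m}" for xs
  proof (rule halted_if_rounds_le)
    have "\<omega> \<in> space (random_bits (clique_path n m xs))"
      using \<omega>(1) by (simp add: random_bits_def)
    then have "rounds A (clique_path n m xs) \<omega> \<le> round_complexity a b A n"
      unfolding round_complexity_def using inst[OF xs] by (intro Sup_upper) force
    then show "rounds A (clique_path n m xs) \<omega> \<le> enat T" using T by simp
  qed
  have indep: "independent_set (clique_path n m xs) (output_set A (clique_path n m xs) \<omega>)"
    if "distinct xs" "set xs = {..<m}" for xs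
    using \<omega>(2)[OF that] by (simp add: finds_large_independent_set_def)
  define k where "k = 2 * T + 3"
  define r where "r = k + 36 * C * C"
  \<comment> \<open>\<open>tower r\<close> absorbs the product \<open>36 * C * C * k\<close>, and
    \<open>2 * T + 2\<close> more levels absorb the iterated exponential. The outer factor
    \<open>18 * C\<close> then costs one last level, because the square of \<open>tower q\<close> is
    below \<open>2 ^ tower q\<close>.\<close>
  define q where "q = 2 * T + 2 + r"
  have qL: "Suc q \<le> L - 4" using L by (simp add: q_def r_def k_def)
  have y: "5 \<le> tower q" "36 * C * C \<le> tower q"
    using less_tower[of q] by (auto simp: q_def r_def k_def)
  have C2: "C \<le> C * C" using C by simp
  have "k * (36 * C * C) \<le> 2 ^ k * 2 ^ (36 * C * C)"
    by (intro mult_le_mono) (auto intro: less_imp_le less_exp)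
  also have "\<dots> \<le> tower r" using power_le_tower[of r] by (simp add: r_def power_add)
  finally have kr: "36 * C * C * k \<le> tower r" by (simp add: mult.commute)
  have rq: "tower r \<le> tower q" by (rule tower_mono) (simp add: q_def)
  have qm: "tower q < m"
    using less_le_trans[OF less_exp[of "tower q"]] tower_mono[OF qL] by (simp add: m_def)
  have l1: "6 * C * (6 * C * (2 * T + 3)) < m"
    using kr rq qm by (simp add: k_def[symmetric] mult.assoc mult.left_commute)
  have "Suc (18 * C * k) \<le> 36 * C * C * k"
  proof -
    have "18 * C * k \<le> 18 * (C * C) * k" using C2 by (intro mult_le_mono) auto
    moreover have "1 \<le> 18 * (C * C) * k" using C by (simp add: k_def Suc_le_eq)
    moreover have "36 * C * C * k = 18 * (C * C) * k + 18 * (C * C) * k" by simp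
    ultimately show ?thesis by linarith
  qed
  then have "((\<lambda>x. 2 ^ x) ^^ (2 * T + 2)) (Suc (18 * C * k)) \<le> tower q"
    unfolding q_def using kr by (intro funpow_le_tower) simp
  then have "18 * C * ((\<lambda>x. 2 ^ x) ^^ (2 * T + 2)) (Suc (18 * C * k)) \<le> tower q * tower q"
  proof (intro mult_le_mono)
    have "36 * C * C = 36 * (C * C)" by simp
    then show "18 * C \<le> tower q" using y(2) C2 by linarith
  qed
  also have "\<dots> < 2 ^ tower q" by (rule square_less_power_of_two[OF y(1)])
  also have "\<dots> \<le> m" using tower_mono[OF qL] by (simp add: m_def)
  finally have l2: "18 * C * ((\<lambda>x. 2 ^ x) ^^ (2 * T + 2)) (Suc (18 * C * (2 * T + 3))) < m"
    by (simp add: k_def)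
  have "\<exists>xs. distinct xs \<and> set xs = {..<m} \<and>
      6 * C * card (output_set A (clique_path n m xs) \<omega>) < m"
    by (rule deterministic_lower_bound[OF mpos l1 l2 C(1)]) (rule halts indep; assumption)+
  then obtain xs where xs: "distinct xs" "set xs = {..<m}"
      and small: "6 * C * card (output_set A (clique_path n m xs) \<omega>) < m"
    by blast
  define \<Delta> where "\<Delta> = max_degree (clique_path n m xs)"
  have \<Delta>: "1 \<le> \<Delta>" "\<Delta> \<le> 3 * (n div m + 1)"
    unfolding \<Delta>_def using clique_path_max_degree[OF xs mpos mn] by auto
  \<comment> \<open>As the maximum degree is at most \<open>6 * n / m\<close>, a successful output
    has at least \<open>m / (6 * C)\<close> vertices, against \<open>small\<close>.\<close>
  have "m * \<Delta> \<le> 3 * (m * (n div m) + m)" using mult_le_mono2[OF \<Delta>(2), of m] by (simp add: algebra_simps)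
  also have "\<dots> \<le> 3 * (n + n)" using mn by (intro mult_le_mono2 add_mono) auto
  finally have "real (m * \<Delta>) \<le> real (3 * (n + n))" by (simp only: of_nat_le_iff)
  then have md: "real m * real \<Delta> \<le> 6 * real n" by simp
  have "real m / 6 \<le> real n / real \<Delta>" using md \<Delta>(1) by (simp add: field_simps)
  then have "1 / real C * (real m / 6) \<le> \<kappa> * (real n / real \<Delta>)"
    using C by (intro mult_mono) (auto intro: order_trans[OF _ C(2)])
  also have "\<dots> \<le> real (card (output_set A (clique_path n m xs) \<omega>))"
    using \<omega>(2)[OF xs] by (simp add: finds_large_independent_set_def \<Delta>_def)
  finally have "real m \<le> 6 * real C * real (card (output_set A (clique_path n m xs) \<omega>))"
    using C(1) by (simp add: field_simps)
  also have "\<dots> = real (6 * C * card (output_set A (clique_path n m xs) \<omega>))" by simp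
  also have "\<dots> < real m" using small by (simp only: of_nat_less_iff)
  finally show False by simp
qed

theorem theorem4:
  fixes \<kappa> :: real and a b :: nat and A :: "('s, 'm) local_algorithm"
  assumes "\<kappa> > 0" and "a \<ge> 1" and "b \<ge> 1"
    and "\<And>G. local_instance a b G \<Longrightarrow>
           success_probability \<kappa> A G \<ge> 1 - 1 / log 2 (real (card (verts G)))"
  shows "\<exists>c::real. c > 0 \<and>
           (\<forall>\<^sub>F n in sequentially.
              ereal (c * real (log_star n)) \<le> ereal_of_enat (round_complexity a b A n))"
proof -
  obtain C0 where C0: "1 / \<kappa> < real C0" using reals_Archimedean2 by blast
  define C where "C = Suc C0"
  have C: "C > 0" "1 / real C \<le> \<kappa>"
    using C0 assms(1) by (auto simp: C_def field_simps)
  define K where "K = 36 * C * C + 20"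
  \<comment> \<open>For large \<open>n\<close> the additive constant \<open>K\<close> is at most
    half of \<open>log_star n\<close>, so the bound \<open>4 * T + K\<close> turns into
    \<open>8 * T\<close>. An infinite round complexity satisfies the claim trivially.\<close>
  have "ereal (1 / 8 * real (log_star n)) \<le> ereal_of_enat (round_complexity a b A n)"
    if n: "tower (2 * K) \<le> n" for n
  proof (cases "round_complexity a b A n")
    case (enat T)
    have "2 * K \<le> log_star n" by (rule le_log_star[OF n])
    moreover have "log_star n < 4 * T + K"
      using log_star_less[OF C assms(2,3,4), of n T] enat by (simp add: K_def)
    ultimately have "log_star n \<le> 8 * T" by linarith
    then show ?thesis using enat by simp
  qed simp
  then show ?thesis
    by (intro exI[of _ "1 / 8"]) (auto simp: eventually_at_top_linorder)
qed

end
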